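(* Let $X_1,\dots,X_n,Y$ be Banach spaces over the same field ($\mathbb R$ or $\mathbb C$). If $1\le p\le q<\infty$, then $$\Pi_p^{Lip}(X_1,\dots,X_n;Y)\subset\Pi_q^{Lip}(X_1,\dots,X_n;Y)$$ and $\pi_q^{Lip}(T)\le\pi_p^{Lip}(T)$ for every $T\in\Pi_p^{Lip}(X_1,\dots,X_n;Y)$.
   Context: $\mathcal L(X_1,\dots,X_n)$ is the space of bounded scalar $n$-linear forms with the supremum norm over the product of unit balls, $B_E$ the closed unit ball of $E$. For $1\le p<\infty$, a bounded $n$-linear operator $T:X_1\times\cdots\times X_n\to Y$ is Lipschitz $p$-summing, $T\in\Pi_p^{Lip}(X_1,\dots,X_n;Y)$, if there is $c>0$ such that for all $k\in\mathbb N$ and all $u_1,\dots,u_k,v_1,\dots,v_k\in X_1\times\cdots\times X_n$, $$\Big(\sum_{i=1}^k\|T(u_i)-T(v_i)\|^p\Big)^{1/p}\le c\cdot\sup_{\varphi\in B_{\mathcal L(X_1,\dots,X_n)}}\Big(\sum_{i=1}^k|\varphi(u_i)-\varphi(v_i)|^p\Big)^{1/p};$$ $\pi_p^{Lip}(T)$ is the infimum of such constants $c$. *)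

theory Defs
  imports Complex_Main "HOL-Algebra.Module"
begin

text \<open>
  The spaces \<open>X\<^sub>1, \<dots>, X\<^sub>n\<close> are in general different and may be complex, so they are given
  by explicit carriers: a family \<open>X :: nat \<Rightarrow> ('k, 'a) normed_module\<close> read at the indices
  \<open>1, \<dots>, n\<close>. The members of a family share the type \<open>'a\<close> only; each has its own carrier,
  operations and norm. As in every HOL-Algebra module, the ring multiplication and unit of
  the record play no role.

  The scalar type \<open>'k\<close> ranges over the class \<open>real_normed_field\<close>. Its instances include
  \<open>real\<close> and \<open>complex\<close>, and up to isometric isomorphism there are no others
  (Gelfand-Mazur).
\<close>

record ('k, 'a) normed_module = "('k, 'a) module" +
  vnorm :: "'a \<Rightarrow> real"

text \<open>The field \<open>'k\<close> as a ring record and at the same time as a normed space over itself.\<close>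

definition scalars :: "('k::real_normed_field, 'k) normed_module" where
  "scalars = \<lparr>carrier = UNIV, mult = (*), one = 1, zero = 0, add = (+), smult = (*), vnorm = norm\<rparr>"

locale normed_vector_space = module scalars X
  for X :: "('k::real_normed_field, 'a) normed_module" +
  assumes vnorm_nonneg: "x \<in> carrier X \<Longrightarrow> 0 \<le> vnorm X x"
    and vnorm_eq_zero: "x \<in> carrier X \<Longrightarrow> vnorm X x = 0 \<longleftrightarrow> x = \<zero>\<^bsub>X\<^esub>"
    and vnorm_smult: "x \<in> carrier X \<Longrightarrow> vnorm X (a \<odot>\<^bsub>X\<^esub> x) = norm a * vnorm X x"
    and vnorm_triangle: "\<lbrakk>x \<in> carrier X; y \<in> carrier X\<rbrakk>
          \<Longrightarrow> vnorm X (x \<oplus>\<^bsub>X\<^esub> y) \<le> vnorm X x + vnorm X y"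

locale banach_space = normed_vector_space X
  for X :: "('k::real_normed_field, 'a) normed_module" +
  assumes complete: "\<lbrakk>\<And>i. s i \<in> carrier X;
      \<And>e. 0 < e \<Longrightarrow> \<exists>N. \<forall>i\<ge>N. \<forall>j\<ge>N. vnorm X (s i \<ominus>\<^bsub>X\<^esub> s j) < e\<rbrakk>
      \<Longrightarrow> \<exists>l\<in>carrier X. (\<lambda>i. vnorm X (s i \<ominus>\<^bsub>X\<^esub> l)) \<longlonglongrightarrow> 0"

definition unit_ball :: "('k, 'a) normed_module \<Rightarrow> 'a set" where
  "unit_ball X = {x \<in> carrier X. vnorm X x \<le> 1}"

definition prod_space :: "nat \<Rightarrow> (nat \<Rightarrow> ('k, 'a) normed_module) \<Rightarrow> (nat \<Rightarrow> 'a) set" where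
  "prod_space n X = (\<Pi>\<^sub>E i\<in>{1..n}. carrier (X i))"

definition multilinear ::
  "nat \<Rightarrow> (nat \<Rightarrow> ('k, 'a) normed_module) \<Rightarrow> ('k, 'b) normed_module \<Rightarrow> ((nat \<Rightarrow> 'a) \<Rightarrow> 'b) \<Rightarrow> bool"
  where
  "multilinear n X Y T \<longleftrightarrow>
     T \<in> prod_space n X \<rightarrow>\<^sub>E carrier Y \<and>
     (\<forall>u\<in>prod_space n X. \<forall>i\<in>{1..n}. \<forall>x\<in>carrier (X i). \<forall>y\<in>carrier (X i).
        T (u(i := x \<oplus>\<^bsub>X i\<^esub> y)) = T (u(i := x)) \<oplus>\<^bsub>Y\<^esub> T (u(i := y))) \<and>
     (\<forall>u\<in>prod_space n X. \<forall>i\<in>{1..n}. \<forall>x\<in>carrier (X i). \<forall>a.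
        T (u(i := a \<odot>\<^bsub>X i\<^esub> x)) = a \<odot>\<^bsub>Y\<^esub> T (u(i := x)))"

definition bounded_multilinear ::
  "nat \<Rightarrow> (nat \<Rightarrow> ('k, 'a) normed_module) \<Rightarrow> ('k, 'b) normed_module \<Rightarrow> ((nat \<Rightarrow> 'a) \<Rightarrow> 'b) set"
  where
  "bounded_multilinear n X Y =
     {T. multilinear n X Y T \<and>
         bdd_above ((\<lambda>u. vnorm Y (T u)) ` (\<Pi>\<^sub>E i\<in>{1..n}. unit_ball (X i)))}"

definition sup_norm ::
  "nat \<Rightarrow> (nat \<Rightarrow> ('k, 'a) normed_module) \<Rightarrow> ('k, 'b) normed_module \<Rightarrow> ((nat \<Rightarrow> 'a) \<Rightarrow> 'b) \<Rightarrow> real"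
  where
  "sup_norm n X Y T = (SUP u\<in>(\<Pi>\<^sub>E i\<in>{1..n}. unit_ball (X i)). vnorm Y (T u))"

definition form_ball ::
  "nat \<Rightarrow> (nat \<Rightarrow> ('k::real_normed_field, 'a) normed_module) \<Rightarrow> ((nat \<Rightarrow> 'a) \<Rightarrow> 'k) set"
  where
  "form_ball n X = {\<phi> \<in> bounded_multilinear n X scalars. sup_norm n X scalars \<phi> \<le> 1}"

text \<open>
  The supremum below is a genuine one: the zero form lies in \<open>form_ball n X\<close>, and
  \<open>\<bar>\<phi> u\<bar> \<le> \<parallel>u\<^sub>1\<parallel> \<cdots> \<parallel>u\<^sub>n\<parallel>\<close> for \<open>\<phi> \<in> form_ball n X\<close>, so the set of values is nonempty and
  bounded.
\<close>

definition lip_summing_bound ::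
  "real \<Rightarrow> nat \<Rightarrow> (nat \<Rightarrow> ('k::real_normed_field, 'a) normed_module) \<Rightarrow> ('k, 'b) normed_module
     \<Rightarrow> ((nat \<Rightarrow> 'a) \<Rightarrow> 'b) \<Rightarrow> real \<Rightarrow> bool"
  where
  "lip_summing_bound p n X Y T c \<longleftrightarrow>
     (\<forall>(k::nat) u v. (\<forall>i\<in>{1..k}. u i \<in> prod_space n X \<and> v i \<in> prod_space n X) \<longrightarrow>
        (\<Sum>i=1..k. vnorm Y (T (u i) \<ominus>\<^bsub>Y\<^esub> T (v i)) powr p) powr (1 / p)
          \<le> c * (SUP \<phi>\<in>form_ball n X.
                   (\<Sum>i=1..k. norm (\<phi> (u i) - \<phi> (v i)) powr p) powr (1 / p)))"

definition lip_summing ::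
  "real \<Rightarrow> nat \<Rightarrow> (nat \<Rightarrow> ('k::real_normed_field, 'a) normed_module) \<Rightarrow> ('k, 'b) normed_module
     \<Rightarrow> ((nat \<Rightarrow> 'a) \<Rightarrow> 'b) set"
  where
  "lip_summing p n X Y =
     {T \<in> bounded_multilinear n X Y. \<exists>c>0. lip_summing_bound p n X Y T c}"

definition lip_summing_norm ::
  "real \<Rightarrow> nat \<Rightarrow> (nat \<Rightarrow> ('k::real_normed_field, 'a) normed_module) \<Rightarrow> ('k, 'b) normed_module
     \<Rightarrow> ((nat \<Rightarrow> 'a) \<Rightarrow> 'b) \<Rightarrow> real"
  where
  "lip_summing_norm p n X Y T = Inf {c. 0 < c \<and> lip_summing_bound p n X Y T c}"

end

theory Submission
  imports Defs "HOL-Analysis.Convex"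
begin

text \<open>
  Write \<open>d\<^sub>i = \<parallel>T u\<^sub>i - T v\<^sub>i\<parallel>\<close>. Multilinearity turns the defining inequality into a weighted one:
  multiplying the first coordinates of \<open>u\<^sub>i\<close> and \<open>v\<^sub>i\<close> by a scalar \<open>s\<^sub>i \<ge> 0\<close> multiplies \<open>d\<^sub>i\<close> and all
  the differences \<open>\<bar>\<phi> u\<^sub>i - \<phi> v\<^sub>i\<bar>\<close> by \<open>s\<^sub>i\<close>. For \<open>p < q\<close> the weights \<open>s\<^sub>i = d\<^sub>i powr (q / p - 1)\<close> make
  the left-hand side of the inequality for \<open>p\<close> equal to \<open>D powr (1 / p)\<close>, where
  \<open>D = (\<Sum>i. d\<^sub>i powr q)\<close>. On the right-hand side, Hoelder's inequality with exponents \<open>q / p\<close> and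
  \<open>q / (q - p)\<close> (\<open>sum_Hoelder\<close>) splits off the factor \<open>D powr (1 / p - 1 / q)\<close> and leaves the
  supremum that belongs to \<open>q\<close>. Cancelling this factor gives the inequality for \<open>q\<close> with the same
  constant \<open>c\<close> (\<open>lip_summing_bound_mono\<close>), hence both the inclusion and the comparison of the
  infima.

  The argument estimates each form by the supremum belonging to \<open>q\<close>. This is legitimate
  because forms in the unit ball are bounded uniformly at every point (\<open>form_ball_bounded\<close>).
\<close>

section \<open>Hoelder's inequality for finite sums\<close>

text \<open>
  After normalising \<open>a\<close> and \<open>b\<close> to have sum one, the weighted inequality between the arithmetic
  and geometric means holds termwise, and its right-hand sides add up to one.
\<close>

lemma sum_Hoelder:
  fixes a b :: "'i \<Rightarrow> real"
  assumes "finite I" and a: "\<And>i. i \<in> I \<Longrightarrow> 0 \<le> a i" and b: "\<And>i. i \<in> I \<Longrightarrow> 0 \<le> b i"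
    and t: "0 < t" "t < 1"
  shows "(\<Sum>i\<in>I. a i powr (1 - t) * b i powr t)
           \<le> (\<Sum>i\<in>I. a i) powr (1 - t) * (\<Sum>i\<in>I. b i) powr t"
proof (cases "sum a I = 0 \<or> sum b I = 0")
  case True
  then have "a i powr (1 - t) * b i powr t = 0" if "i \<in> I" for i
    using assms that by (auto simp: sum_nonneg_eq_0_iff)
  then have "(\<Sum>i\<in>I. a i powr (1 - t) * b i powr t) = 0"
    by (intro sum.neutral) blast
  then show ?thesis
    by simp
next
  case False
  define A where "A = sum a I"
  define B where "B = sum b I"
  have pos: "0 < A" "0 < B"
    using False a b unfolding A_def B_def by (smt (verit) sum_nonneg)+
  have "a i powr (1 - t) * b i powr t
          \<le> A powr (1 - t) * B powr t * ((1 - t) * (a i / A) + t * (b i / B))" if "i \<in> I" for i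
  proof (cases "a i = 0 \<or> b i = 0")
    case True
    then show ?thesis
      using that a b t pos by auto
  next
    case False
    then have "(a i / A) powr (1 - t) * (b i / B) powr t \<le> (1 - t) * (a i / A) + t * (b i / B)"
      using that a[OF that] b[OF that] t pos by (intro Youngs_inequality_0) auto
    then show ?thesis
      using that a[OF that] b[OF that] pos by (simp add: powr_divide field_simps)
  qed
  then have "(\<Sum>i\<in>I. a i powr (1 - t) * b i powr t)
      \<le> (\<Sum>i\<in>I. A powr (1 - t) * B powr t * ((1 - t) * (a i / A) + t * (b i / B)))"
    by (rule sum_mono)
  also have "\<dots> = A powr (1 - t) * B powr t * ((1 - t) * (sum a I / A) + t * (sum b I / B))"
    by (simp add: sum_distrib_left[symmetric] sum.distrib sum_divide_distrib[symmetric])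
  also have "\<dots> = A powr (1 - t) * B powr t"
    using pos by (simp add: A_def[symmetric] B_def[symmetric])
  finally show ?thesis
    by (simp add: A_def B_def)
qed

section \<open>Homogeneity of multilinear maps\<close>

lemma scalars_simps [simp]:
  "carrier scalars = UNIV" "vnorm scalars = norm"
  "x \<oplus>\<^bsub>scalars\<^esub> y = x + y" "a \<odot>\<^bsub>scalars\<^esub> x = a * x"
  by (simp_all add: scalars_def)

lemma (in normed_vector_space) smult_in_carrier:
  "x \<in> carrier X \<Longrightarrow> a \<odot>\<^bsub>X\<^esub> x \<in> carrier X"
  by (simp add: smult_closed)

lemma (in normed_vector_space) zero_in_unit_ball: "\<zero>\<^bsub>X\<^esub> \<in> unit_ball X"
  using vnorm_eq_zero[of "\<zero>\<^bsub>X\<^esub>"] by (simp add: unit_ball_def)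

lemma (in normed_vector_space) smult_diff:
  assumes "x \<in> carrier X" "y \<in> carrier X"
  shows "a \<odot>\<^bsub>X\<^esub> x \<ominus>\<^bsub>X\<^esub> a \<odot>\<^bsub>X\<^esub> y = a \<odot>\<^bsub>X\<^esub> (x \<ominus>\<^bsub>X\<^esub> y)"
  using assms by (simp add: a_minus_def smult_r_distr smult_r_minus)

lemma prod_space_upd:
  "u \<in> prod_space n X \<Longrightarrow> i \<in> {1..n} \<Longrightarrow> x \<in> carrier (X i) \<Longrightarrow> u(i := x) \<in> prod_space n X"
  using PiE_fun_upd[of x "\<lambda>i. carrier (X i)" i u "{1..n}"]
  by (simp add: prod_space_def insert_absorb)

lemma prod_space_carrier: "u \<in> prod_space n X \<Longrightarrow> i \<in> {1..n} \<Longrightarrow> u i \<in> carrier (X i)"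
  by (auto simp: prod_space_def)

lemma multilinear_smult:
  assumes "multilinear n X Y T" "u \<in> prod_space n X" "i \<in> {1..n}"
  shows "T (u(i := a \<odot>\<^bsub>X i\<^esub> u i)) = a \<odot>\<^bsub>Y\<^esub> T u"
proof -
  have "T (u(i := a \<odot>\<^bsub>X i\<^esub> u i)) = a \<odot>\<^bsub>Y\<^esub> T (u(i := u i))"
    using assms prod_space_carrier[OF assms(2,3)] unfolding multilinear_def by blast
  then show ?thesis
    by simp
qed

lemma multilinear_smult_coordinates:
  assumes X: "\<And>i. i \<in> {1..n} \<Longrightarrow> normed_vector_space (X i)"
    and ml: "multilinear n X scalars \<phi>" and u: "u \<in> prod_space n X" and "S \<subseteq> {1..n}"
  shows "(\<lambda>i. if i \<in> S then a i \<odot>\<^bsub>X i\<^esub> u i else u i) \<in> prod_space n X \<and>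
         \<phi> (\<lambda>i. if i \<in> S then a i \<odot>\<^bsub>X i\<^esub> u i else u i) = prod a S * \<phi> u"
proof -
  have "finite S"
    using \<open>S \<subseteq> {1..n}\<close> finite_subset by blast
  then show ?thesis
    using \<open>S \<subseteq> {1..n}\<close>
  proof (induction S)
    case empty
    then show ?case
      using u by simp
  next
    case (insert j S)
    let ?w = "\<lambda>i. if i \<in> S then a i \<odot>\<^bsub>X i\<^esub> u i else u i"
    have j: "j \<in> {1..n}" and w: "?w \<in> prod_space n X" "\<phi> ?w = prod a S * \<phi> u"
      using insert by auto
    have eq: "(\<lambda>i. if i \<in> insert j S then a i \<odot>\<^bsub>X i\<^esub> u i else u i) = ?w(j := a j \<odot>\<^bsub>X j\<^esub> u j)"
      by auto
    have uj: "u j \<in> carrier (X j)"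
      using u j by (rule prod_space_carrier)
    have "\<phi> (?w(j := a j \<odot>\<^bsub>X j\<^esub> u j)) = a j * \<phi> ?w"
      using multilinear_smult[OF ml w(1) j, of "a j"] \<open>j \<notin> S\<close> by simp
    moreover have "?w(j := a j \<odot>\<^bsub>X j\<^esub> u j) \<in> prod_space n X"
      using w(1) j normed_vector_space.smult_in_carrier[OF X[OF j] uj] by (rule prod_space_upd)
    ultimately show ?case
      unfolding eq using w(2) insert(1,2) by simp
  qed
qed

section \<open>The unit ball of multilinear forms\<close>

lemma zero_in_form_ball:
  fixes X :: "nat \<Rightarrow> ('k::real_normed_field, 'a) normed_module"
  assumes X: "\<And>i. i \<in> {1..n} \<Longrightarrow> normed_vector_space (X i)"
  shows "(\<lambda>u\<in>prod_space n X. 0) \<in> form_ball n X"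
proof -
  let ?U = "\<Pi>\<^sub>E i\<in>{1..n}. unit_ball (X i)"
  let ?\<phi> = "\<lambda>u\<in>prod_space n X. 0 :: 'k"
  have "(\<lambda>i\<in>{1..n}. \<zero>\<^bsub>X i\<^esub>) \<in> ?U"
    using normed_vector_space.zero_in_unit_ball[OF X] by auto
  then have ne: "?U \<noteq> {}"
    by blast
  have "?U \<subseteq> prod_space n X"
    by (auto simp: prod_space_def unit_ball_def PiE_def Pi_def)
  then have zero: "vnorm scalars (?\<phi> u) = 0" if "u \<in> ?U" for u
    using that by auto
  have "x \<oplus>\<^bsub>X i\<^esub> y \<in> carrier (X i)"
    if "i \<in> {1..n}" "x \<in> carrier (X i)" "y \<in> carrier (X i)" for i x y
  proof -
    interpret normed_vector_space "X i"
      using X[OF that(1)] .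
    show ?thesis
      using that by simp
  qed
  then have "multilinear n X scalars ?\<phi>"
    unfolding multilinear_def
    using normed_vector_space.smult_in_carrier[OF X] by (auto simp: prod_space_upd)
  moreover have "bdd_above ((\<lambda>u. vnorm scalars (?\<phi> u)) ` ?U)"
    using zero by (intro bdd_aboveI[of _ 0]) auto
  moreover have "sup_norm n X scalars ?\<phi> \<le> 1"
    unfolding sup_norm_def using ne zero by (intro cSUP_least) auto
  ultimately show ?thesis
    by (simp add: form_ball_def bounded_multilinear_def)
qed

text \<open>
  Dividing every coordinate \<open>u\<^sub>i\<close> by \<open>1 + \<parallel>u\<^sub>i\<parallel>\<close> moves \<open>u\<close> into the product of the unit balls. The
  summand \<open>1\<close> avoids a case distinction for vanishing coordinates.
\<close>

lemma form_ball_bounded: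
  fixes X :: "nat \<Rightarrow> ('k::real_normed_field, 'a) normed_module"
  assumes X: "\<And>i. i \<in> {1..n} \<Longrightarrow> normed_vector_space (X i)"
    and \<phi>: "\<phi> \<in> form_ball n X" and u: "u \<in> prod_space n X"
  shows "norm (\<phi> u) \<le> (\<Prod>i\<in>{1..n}. 1 + vnorm (X i) (u i))"
proof -
  let ?U = "\<Pi>\<^sub>E i\<in>{1..n}. unit_ball (X i)"
  define r where "r i = 1 + vnorm (X i) (u i)" for i
  define a :: "nat \<Rightarrow> 'k" where "a i = of_real (1 / r i)" for i
  let ?w = "\<lambda>i. if i \<in> {1..n} then a i \<odot>\<^bsub>X i\<^esub> u i else u i"
  have r: "1 \<le> r i" if "i \<in> {1..n}" for i
    using normed_vector_space.vnorm_nonneg[OF X[OF that] prod_space_carrier[OF u that]]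
    by (simp add: r_def)
  have norm_a: "norm (a i) = 1 / r i" if "i \<in> {1..n}" for i
    using r[OF that] by (simp add: a_def norm_divide)
  have ml: "multilinear n X scalars \<phi>"
    and bdd: "bdd_above ((\<lambda>u. vnorm scalars (\<phi> u)) ` ?U)"
    and sup: "(SUP u\<in>?U. vnorm scalars (\<phi> u)) \<le> 1"
    using \<phi> by (auto simp: form_ball_def bounded_multilinear_def sup_norm_def)
  have w: "?w \<in> prod_space n X" "\<phi> ?w = prod a {1..n} * \<phi> u"
    using multilinear_smult_coordinates[OF X ml u order_refl, of a] by auto
  have "?w i \<in> unit_ball (X i)" if "i \<in> {1..n}" for i
  proof -
    have ui: "u i \<in> carrier (X i)"
      using u that by (rule prod_space_carrier)
    have "vnorm (X i) (a i \<odot>\<^bsub>X i\<^esub> u i) = 1 / r i * vnorm (X i) (u i)"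
      using normed_vector_space.vnorm_smult[OF X[OF that] ui] norm_a[OF that] by simp
    also have "\<dots> \<le> 1"
      using r[OF that] by (simp add: r_def field_simps)
    finally show ?thesis
      using that normed_vector_space.smult_in_carrier[OF X[OF that] ui]
      by (simp add: unit_ball_def)
  qed
  then have "?w \<in> ?U"
    using w(1) by (auto simp: prod_space_def PiE_def extensional_def)
  then have "norm (\<phi> ?w) \<le> 1"
    using cSUP_upper[OF _ bdd, of ?w] sup by simp
  moreover have "norm (prod a {1..n}) = 1 / prod r {1..n}"
    using norm_a by (simp add: prod_norm[symmetric] prod_dividef)
  moreover have "0 < prod r {1..n}"
    using r by (intro prod_pos) force
  ultimately have "norm (\<phi> u) \<le> prod r {1..n}"
    unfolding w(2) by (simp add: norm_mult field_simps)
  then show ?thesis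
    by (simp add: r_def)
qed

text \<open>
  An unbounded set of reals has a meaningless supremum, so this fact is what makes the right-hand
  side of the summing inequality an upper bound for the individual forms.
\<close>

lemma bdd_above_form_ball_sums:
  fixes X :: "nat \<Rightarrow> ('k::real_normed_field, 'a) normed_module" and u v :: "nat \<Rightarrow> nat \<Rightarrow> 'a"
  assumes X: "\<And>i. i \<in> {1..n} \<Longrightarrow> normed_vector_space (X i)" and "0 < q"
    and uv: "\<And>i. i \<in> {1..k::nat} \<Longrightarrow> u i \<in> prod_space n X \<and> v i \<in> prod_space n X"
  shows "bdd_above ((\<lambda>\<phi>. (\<Sum>i=1..k. norm (\<phi> (u i) - \<phi> (v i)) powr q) powr (1 / q)) ` form_ball n X)"
proof -
  define C where "C w = (\<Prod>i\<in>{1..n}. 1 + vnorm (X i) (w i))" for w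
  have "(\<Sum>i=1..k. norm (\<phi> (u i) - \<phi> (v i)) powr q) powr (1 / q)
          \<le> (\<Sum>i=1..k. (C (u i) + C (v i)) powr q) powr (1 / q)" if "\<phi> \<in> form_ball n X" for \<phi>
  proof -
    have "norm (\<phi> (u i) - \<phi> (v i)) \<le> C (u i) + C (v i)" if "i \<in> {1..k}" for i
      unfolding C_def using uv[OF that] form_ball_bounded[OF X \<open>\<phi> \<in> form_ball n X\<close>]
      by (intro norm_triangle_le_diff add_mono) auto
    then show ?thesis
      using \<open>0 < q\<close> by (intro powr_mono2 sum_mono sum_nonneg) auto
  qed
  then show ?thesis
    by (intro bdd_aboveI2)
qed

section \<open>Monotonicity in the exponent\<close>

text \<open>
  The inequality for \<open>p\<close> is applied to the points \<open>u\<^sub>i\<close>, \<open>v\<^sub>i\<close> with first coordinate multiplied by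
  \<open>s\<^sub>i = d\<^sub>i powr (q / p - 1)\<close>. It becomes \<open>D powr (1 / p) \<le> c * D powr (1 / p - 1 / q) * M\<close>, where
  \<open>M\<close> is the supremum for \<open>q\<close>, and division by the power of \<open>D\<close> keeps the constant \<open>c\<close>.
\<close>

lemma lip_summing_bound_mono:
  fixes X :: "nat \<Rightarrow> ('k::real_normed_field, 'a) normed_module"
    and Y :: "('k, 'b) normed_module"
  assumes n: "1 \<le> n"
    and X: "\<And>i. i \<in> {1..n} \<Longrightarrow> normed_vector_space (X i)"
    and Y: "normed_vector_space Y"
    and pq: "0 < p" "p \<le> q"
    and ml: "multilinear n X Y T" and c: "0 \<le> c"
    and bound: "lip_summing_bound p n X Y T c"
  shows "lip_summing_bound q n X Y T c"
proof (cases "p = q")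
  case True
  then show ?thesis
    using bound by simp
next
  \<comment> \<open>Only now are both Hoelder exponents \<open>q / p\<close> and \<open>q / (q - p)\<close> finite.\<close>
  case False
  then have less: "p < q"
    using pq by simp
  interpret Y: normed_vector_space Y
    by (fact Y)
  show ?thesis
    unfolding lip_summing_bound_def
  proof (intro allI impI)
    fix k :: nat and u v :: "nat \<Rightarrow> nat \<Rightarrow> 'a"
    assume uv: "\<forall>i\<in>{1..k}. u i \<in> prod_space n X \<and> v i \<in> prod_space n X"
    define d where "d i = vnorm Y (T (u i) \<ominus>\<^bsub>Y\<^esub> T (v i))" for i
    define f where "f \<phi> i = norm (\<phi> (u i) - \<phi> (v i))" for \<phi> :: "(nat \<Rightarrow> 'a) \<Rightarrow> 'k" and i
    define D where "D = (\<Sum>i=1..k. d i powr q)"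
    define F where "F \<phi> = (\<Sum>i=1..k. f \<phi> i powr q)" for \<phi>
    define M where "M = (SUP \<phi>\<in>form_ball n X. F \<phi> powr (1 / q))"
    \<comment> \<open>Chosen so that \<open>s\<^sub>i * d\<^sub>i = d\<^sub>i powr (q / p)\<close> and \<open>s\<^sub>i powr p = d\<^sub>i powr (q - p)\<close>, also for \<open>d\<^sub>i = 0\<close>.\<close>
    define s where "s i = d i powr (q / p - 1)" for i
    define scale where "scale w i = (w i)(1 := of_real (s i) \<odot>\<^bsub>X 1\<^esub> w i 1)"
      for w :: "nat \<Rightarrow> nat \<Rightarrow> 'a" and i
    have one: "1 \<in> {1..n}"
      using n by simp
    have T: "T w \<in> carrier Y" if "w \<in> prod_space n X" for w
      using ml that by (auto simp: multilinear_def)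
    have d_nonneg: "0 \<le> d i" if "i \<in> {1..k}" for i
      unfolding d_def using uv that T by (intro Y.vnorm_nonneg) simp
    have bdd: "bdd_above ((\<lambda>\<phi>. F \<phi> powr (1 / q)) ` form_ball n X)"
      unfolding F_def f_def using uv pq by (intro bdd_above_form_ball_sums[OF X]) auto
    have le_M: "F \<phi> powr (1 / q) \<le> M" if "\<phi> \<in> form_ball n X" for \<phi>
      unfolding M_def using that bdd by (rule cSUP_upper)
    have M_nonneg: "0 \<le> M"
      using le_M[OF zero_in_form_ball[OF X]] powr_ge_zero order_trans by blast
    have scale_in: "scale w i \<in> prod_space n X" if "w i \<in> prod_space n X" for w i
      unfolding scale_def
      using that one normed_vector_space.smult_in_carrier[OF X[OF one] prod_space_carrier[OF that one]]
      by (rule prod_space_upd)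
    have s_nonneg: "0 \<le> s i" for i
      by (simp add: s_def)
    have d_scale: "vnorm Y (T (scale u i) \<ominus>\<^bsub>Y\<^esub> T (scale v i)) powr p = d i powr q"
      if "i \<in> {1..k}" for i
    proof -
      have "T (scale u i) = of_real (s i) \<odot>\<^bsub>Y\<^esub> T (u i)" "T (scale v i) = of_real (s i) \<odot>\<^bsub>Y\<^esub> T (v i)"
        unfolding scale_def using uv that by (intro multilinear_smult[OF ml _ one]; blast)+
      then have "vnorm Y (T (scale u i) \<ominus>\<^bsub>Y\<^esub> T (scale v i)) = s i * d i"
        using uv that T s_nonneg by (simp add: Y.smult_diff Y.vnorm_smult d_def)
      also have "\<dots> = d i powr (q / p)"
        using d_nonneg[OF that] by (cases "d i = 0") (auto simp: s_def powr_diff)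
      finally show ?thesis
        using pq by (simp add: powr_powr)
    qed
    have f_scale: "norm (\<phi> (scale u i) - \<phi> (scale v i)) powr p
        = (d i powr q) powr (1 - p / q) * (f \<phi> i powr q) powr (p / q)"
      if "\<phi> \<in> form_ball n X" "i \<in> {1..k}" for \<phi> i
    proof -
      have ml\<phi>: "multilinear n X scalars \<phi>"
        using that(1) by (simp add: form_ball_def bounded_multilinear_def)
      have "\<phi> (scale u i) = of_real (s i) * \<phi> (u i)" "\<phi> (scale v i) = of_real (s i) * \<phi> (v i)"
        unfolding scale_def using uv that(2) multilinear_smult[OF ml\<phi> _ one] by simp_all
      then have "norm (\<phi> (scale u i) - \<phi> (scale v i)) = s i * f \<phi> i"
        using s_nonneg by (simp add: f_def right_diff_distrib[symmetric] norm_mult)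
      moreover have "s i powr p = (d i powr q) powr (1 - p / q)"
        using pq by (simp add: s_def powr_powr algebra_simps)
      moreover have "f \<phi> i powr p = (f \<phi> i powr q) powr (p / q)"
        using pq by (simp add: powr_powr)
      ultimately show ?thesis
        using s_nonneg by (simp add: powr_mult f_def)
    qed
    have sup_le: "(SUP \<phi>\<in>form_ball n X.
        (\<Sum>i=1..k. norm (\<phi> (scale u i) - \<phi> (scale v i)) powr p) powr (1 / p))
          \<le> D powr (1 / p - 1 / q) * M"
    proof (rule cSUP_least)
      show "form_ball n X \<noteq> {}"
        using zero_in_form_ball[of n X] X by blast
    next
      fix \<phi> assume \<phi>: "\<phi> \<in> form_ball n X"
      have "(\<Sum>i=1..k. norm (\<phi> (scale u i) - \<phi> (scale v i)) powr p)
          = (\<Sum>i=1..k. (d i powr q) powr (1 - p / q) * (f \<phi> i powr q) powr (p / q))"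
        using f_scale[OF \<phi>] by simp
      also have "\<dots> \<le> D powr (1 - p / q) * F \<phi> powr (p / q)"
        unfolding D_def F_def using pq less by (intro sum_Hoelder) auto
      finally have "(\<Sum>i=1..k. norm (\<phi> (scale u i) - \<phi> (scale v i)) powr p) powr (1 / p)
          \<le> (D powr (1 - p / q) * F \<phi> powr (p / q)) powr (1 / p)"
        using pq by (intro powr_mono2 sum_nonneg) auto
      also have "\<dots> = D powr (1 / p - 1 / q) * F \<phi> powr (1 / q)"
        using pq by (simp add: powr_mult powr_powr field_simps)
      also have "\<dots> \<le> D powr (1 / p - 1 / q) * M"
        using le_M[OF \<phi>] by (rule mult_left_mono) simp
      finally show "(\<Sum>i=1..k. norm (\<phi> (scale u i) - \<phi> (scale v i)) powr p) powr (1 / p)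
          \<le> D powr (1 / p - 1 / q) * M" .
    qed
    have "D powr (1 / p) = (\<Sum>i=1..k. vnorm Y (T (scale u i) \<ominus>\<^bsub>Y\<^esub> T (scale v i)) powr p) powr (1 / p)"
      unfolding D_def using d_scale by simp
    also have "\<dots> \<le> c * (SUP \<phi>\<in>form_ball n X.
        (\<Sum>i=1..k. norm (\<phi> (scale u i) - \<phi> (scale v i)) powr p) powr (1 / p))"
      using bound[unfolded lip_summing_bound_def, rule_format, of k "scale u" "scale v"] uv scale_in
      by blast
    also have "\<dots> \<le> c * (D powr (1 / p - 1 / q) * M)"
      using sup_le c by (rule mult_left_mono)
    finally have weighted: "D powr (1 / p) \<le> D powr (1 / p - 1 / q) * (c * M)"
      by (simp add: mult_ac)
    have "D powr (1 / q) \<le> c * M"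
    proof (cases "D = 0")
      case True
      then show ?thesis
        using c M_nonneg by simp
    next
      case False
      have "D powr (1 / p - 1 / q) * D powr (1 / q) = D powr (1 / p)"
        by (simp add: powr_add[symmetric])
      then show ?thesis
        using weighted False by (metis mult_le_cancel_left_pos powr_gt_zero)
    qed
    then show "(\<Sum>i=1..k. vnorm Y (T (u i) \<ominus>\<^bsub>Y\<^esub> T (v i)) powr q) powr (1 / q)
        \<le> c * (SUP \<phi>\<in>form_ball n X. (\<Sum>i=1..k. norm (\<phi> (u i) - \<phi> (v i)) powr q) powr (1 / q))"
      by (simp add: D_def d_def M_def F_def f_def)
  qed
qed

theorem proposition3p8:
  fixes X :: "nat \<Rightarrow> ('k::real_normed_field, 'a) normed_module"
    and Y :: "('k, 'b) normed_module"
    and n :: nat and p q :: real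
  assumes "1 \<le> n"
    and "\<And>i. i \<in> {1..n} \<Longrightarrow> banach_space (X i)"
    and "banach_space Y"
    and "1 \<le> p" and "p \<le> q"
  shows "lip_summing p n X Y \<subseteq> lip_summing q n X Y \<and>
         (\<forall>T\<in>lip_summing p n X Y. lip_summing_norm q n X Y T \<le> lip_summing_norm p n X Y T)"
proof -
  have mono: "lip_summing_bound q n X Y T c"
    if "T \<in> lip_summing p n X Y" "0 < c" "lip_summing_bound p n X Y T c" for T c
  proof (rule lip_summing_bound_mono)
    show "multilinear n X Y T"
      using that by (simp add: lip_summing_def bounded_multilinear_def)
    show "lip_summing_bound p n X Y T c"
      by (fact that)
  qed (use assms that in \<open>auto intro: banach_space.axioms(1)\<close>)
  have "T \<in> lip_summing q n X Y" if T: "T \<in> lip_summing p n X Y" for T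
    using T mono[OF T] by (auto simp: lip_summing_def)
  moreover have "lip_summing_norm q n X Y T \<le> lip_summing_norm p n X Y T"
    if T: "T \<in> lip_summing p n X Y" for T
    unfolding lip_summing_norm_def
  proof (rule cInf_superset_mono)
    show "{c. 0 < c \<and> lip_summing_bound p n X Y T c} \<noteq> {}"
      using T by (auto simp: lip_summing_def)
    show "bdd_below {c. 0 < c \<and> lip_summing_bound q n X Y T c}"
      by (rule bdd_belowI[of _ 0]) auto
    show "{c. 0 < c \<and> lip_summing_bound p n X Y T c} \<subseteq> {c. 0 < c \<and> lip_summing_bound q n X Y T c}"
      using mono[OF T] by blast
  qed
  ultimately show ?thesis
    by blast
qed

end
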